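(* Let $n$ and $k$ be positive integers with $1\leq k\leq \binom{n}{2}$. Then $g(n,k)=\binom{n}{2}$ if $k=\binom{n}{2}$; and for each integer $t$ with $2\leq t\leq n-1$, $$g(n,k)=\begin{cases} k+t-1 & \text{if } \binom{n-t}{2}+t(n-t-1)+1\leq k\leq \binom{n-t}{2}+t(n-t)-1,\\[2pt] k+t-2 & \text{if } k=\binom{n-t}{2}+t(n-t).\end{cases}$$
   Context: All graphs are finite, simple and undirected. For a connected graph $G$, an edge-coloring of $G$ (adjacent edges may receive the same color) is a monochromatic connection coloring (MC-coloring) if any two vertices of $G$ are joined by a path all of whose edges have the same color. The monochromatic connection number $mc(G)$ is the maximum number of colors used in an MC-coloring of $G$. For positive integers $n,k$ with $1\leq k\leq\binom{n}{2}$, $g(n,k)$ is the maximum integer such that every connected graph $G$ on $n$ vertices with $|E(G)|\leq g(n,k)$ satisfies $mc(G)\leq k$. *)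

theory Defs
  imports Complex_Main
begin

text \<open>A graph is given by a vertex set \<open>V\<close> and a set \<open>E\<close> of two-element subsets of \<open>V\<close>.\<close>

definition simple_graph :: "'a set \<Rightarrow> 'a set set \<Rightarrow> bool" where
  "simple_graph V E \<longleftrightarrow> finite V \<and> (\<forall>e\<in>E. e \<subseteq> V \<and> card e = 2)"

definition path_edges :: "'a list \<Rightarrow> 'a set set" where
  "path_edges p = {{p ! i, p ! Suc i} | i. Suc i < length p}"

definition path_between :: "'a set \<Rightarrow> 'a set set \<Rightarrow> 'a \<Rightarrow> 'a \<Rightarrow> 'a list \<Rightarrow> bool" where
  "path_between V E u v p \<longleftrightarrow>
     p \<noteq> [] \<and> hd p = u \<and> last p = v \<and> distinct p \<and> set p \<subseteq> V \<and> path_edges p \<subseteq> E"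

definition connected_graph :: "'a set \<Rightarrow> 'a set set \<Rightarrow> bool" where
  "connected_graph V E \<longleftrightarrow>
     simple_graph V E \<and> V \<noteq> {} \<and> (\<forall>u\<in>V. \<forall>v\<in>V. \<exists>p. path_between V E u v p)"

definition monochromatic :: "('a set \<Rightarrow> nat) \<Rightarrow> 'a set set \<Rightarrow> bool" where
  "monochromatic c F \<longleftrightarrow> (\<forall>e\<in>F. \<forall>f\<in>F. c e = c f)"

definition MC_coloring :: "'a set \<Rightarrow> 'a set set \<Rightarrow> ('a set \<Rightarrow> nat) \<Rightarrow> bool" where
  "MC_coloring V E c \<longleftrightarrow>
     (\<forall>u\<in>V. \<forall>v\<in>V. \<exists>p. path_between V E u v p \<and> monochromatic c (path_edges p))"

text \<open>Only the colors of the edges in \<open>E\<close> count as used. For a connected graph the set below is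
  nonempty (one color suffices) and bounded by \<open>card E\<close>; otherwise \<open>mc V E\<close> is not meaningful.\<close>

definition mc :: "'a set \<Rightarrow> 'a set set \<Rightarrow> nat" where
  "mc V E = Max {card (c ` E) | c. MC_coloring V E c}"

text \<open>The maximum ranges over the possible edge numbers of an \<open>n\<close>-vertex graph, i.e. at most
  \<open>n choose 2\<close>: for \<open>k = n choose 2\<close> the defining condition holds for every integer, so without
  this bound there would be no maximum. For \<open>k < n choose 2\<close> the bound has no effect, because
  the complete graph violates the condition for every larger integer.
  Every finite graph is isomorphic to one whose vertices are natural numbers, so it
  suffices to quantify over these.\<close>

definition g_mc :: "nat \<Rightarrow> nat \<Rightarrow> nat" where
  "g_mc n k = Max {m. m \<le> n choose 2 \<and>
     (\<forall>(V :: nat set) E. connected_graph V E \<and> card V = n \<and> card E \<le> m \<longrightarrow> mc V E \<le> k)}"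

end

theory Submission
  imports Defs
begin

text \<open>In an MC-coloring every nonadjacent pair is joined by a shortest monochromatic path, and the
  pair can be recovered from the first and the last edge of this path. So the number of
  nonadjacent pairs is at most the number of pairs of equally colored edges, which is at most
  \<open>(w + 1) choose 2\<close> if the coloring wastes \<open>w = card E - card (c ` E)\<close> colors. Conversely, when at
  most \<open>s choose 2\<close> pairs are nonadjacent, all of them may lie among the leaves of a star with \<open>s\<close>
  edges; giving the star one color and every other edge a color of its own wastes only \<open>s - 1\<close>
  colors.\<close>

section \<open>Paths\<close>

lemma path_edges_Cons: "path_edges (x # y # p) = insert {x, y} (path_edges (y # p))"
proof -
  have "(\<exists>i. P i) \<longleftrightarrow> P 0 \<or> (\<exists>i. P (Suc i))" for P
    by (metis not0_implies_Suc)
  note this[of "\<lambda>i. e = {(x # y # p) ! i, (x # y # p) ! Suc i} \<and> Suc i < length (x # y # p)" for e]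
  then show ?thesis
    unfolding path_edges_def by auto
qed

lemma path_edges_singleton: "path_edges [x] = {}"
  by (simp add: path_edges_def)

lemma path_edges_rev: "path_edges (rev p) = path_edges p"
proof -
  have sub: "path_edges (rev q) \<subseteq> path_edges q" for q :: "'a list"
  proof
    fix e assume "e \<in> path_edges (rev q)"
    then obtain i where i: "Suc i < length q" "e = {rev q ! i, rev q ! Suc i}"
      by (auto simp: path_edges_def)
    define j where "j = length q - Suc (Suc i)"
    have "rev q ! i = q ! Suc j" "rev q ! Suc i = q ! j" "Suc j < length q"
      using i(1) by (auto simp: rev_nth j_def Suc_diff_Suc)
    with i(2) show "e \<in> path_edges q"
      unfolding path_edges_def by (auto simp: insert_commute)
  qed
  from sub[of p] sub[of "rev p"] show ?thesis by simp
qed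

section \<open>Shortest monochromatic paths\<close>

definition mono_path :: "'a set \<Rightarrow> 'a set set \<Rightarrow> ('a set \<Rightarrow> nat) \<Rightarrow> 'a \<Rightarrow> 'a \<Rightarrow> 'a list \<Rightarrow> bool" where
  "mono_path V E c u v p \<longleftrightarrow> path_between V E u v p \<and> monochromatic c (path_edges p)"

text \<open>Distance within single colors, counted in vertices rather than edges. It is meaningful
  only if some monochromatic path exists, which an MC-coloring guarantees for vertices of
  \<open>V\<close>.\<close>

definition mono_dist :: "'a set \<Rightarrow> 'a set set \<Rightarrow> ('a set \<Rightarrow> nat) \<Rightarrow> 'a \<Rightarrow> 'a \<Rightarrow> nat" where
  "mono_dist V E c u v = (LEAST l. \<exists>p. mono_path V E c u v p \<and> length p = l)"

lemma mono_path_rev: "mono_path V E c u v p \<Longrightarrow> mono_path V E c v u (rev p)"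
  by (simp add: mono_path_def path_between_def path_edges_rev hd_rev last_rev)

lemma mono_path_tl:
  assumes "mono_path V E c u v (u # b # p)"
  shows "mono_path V E c b v (b # p)"
proof -
  have "path_edges (b # p) \<subseteq> path_edges (u # b # p)"
    by (auto simp: path_edges_Cons)
  then have "monochromatic c (path_edges (b # p))"
    using assms unfolding mono_path_def monochromatic_def by blast
  with assms show ?thesis
    by (auto simp: mono_path_def path_between_def path_edges_Cons)
qed

lemma mono_dist_le: "mono_path V E c u v p \<Longrightarrow> mono_dist V E c u v \<le> length p"
  unfolding mono_dist_def by (rule Least_le) blast

lemma mono_dist_commute: "mono_dist V E c u v = mono_dist V E c v u"
  unfolding mono_dist_def by (metis mono_path_rev length_rev)

lemma mono_dist_attained:
  assumes "MC_coloring V E c" "u \<in> V" "v \<in> V"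
  obtains p where "mono_path V E c u v p" "length p = mono_dist V E c u v"
proof -
  have "\<exists>l p. mono_path V E c u v p \<and> length p = l"
    using assms by (auto simp: MC_coloring_def mono_path_def)
  from LeastI_ex[OF this] that show thesis
    unfolding mono_dist_def by blast
qed

section \<open>Nonadjacent pairs and equally colored edges\<close>

text \<open>\<open>e\<close> and \<open>f\<close> play the role of the first and the last edge of a shortest monochromatic path
  from \<open>u\<close> to \<open>v\<close>.\<close>

definition end_edges ::
    "'a set \<Rightarrow> 'a set set \<Rightarrow> ('a set \<Rightarrow> nat) \<Rightarrow> 'a \<Rightarrow> 'a \<Rightarrow> 'a set \<Rightarrow> 'a set \<Rightarrow> bool" where
  "end_edges V E c u v e f \<longleftrightarrow>
     e \<in> E \<and> f \<in> E \<and> e \<noteq> f \<and> c e = c f \<and>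
     (\<exists>b d. e = {u, b} \<and> f = {d, v} \<and>
        mono_dist V E c b v < mono_dist V E c u v \<and>
        mono_dist V E c u d < mono_dist V E c u v \<and>
        mono_dist V E c b d < mono_dist V E c u v)"

text \<open>Reversing the path swaps the roles of its two ends. This matters because an unordered
  pair of edges does not tell which edge comes first.\<close>

lemma end_edges_commute:
  assumes "end_edges V E c u v e f" shows "end_edges V E c v u f e"
proof -
  let ?D = "mono_dist V E c"
  obtain b d where bd: "e = {u, b}" "f = {d, v}" "?D b v < ?D u v" "?D u d < ?D u v" "?D b d < ?D u v"
    using assms unfolding end_edges_def by blast
  have "?D d u < ?D v u" "?D v b < ?D v u" "?D d b < ?D v u"
    using bd(3-5) by (simp_all only: mono_dist_commute[of V E c d] mono_dist_commute[of V E c v])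
  moreover have "f = {v, d}" "e = {b, u}"
    using bd(1,2) by auto
  ultimately show ?thesis
    using assms unfolding end_edges_def by metis
qed

text \<open>Dropping the first vertex, the last vertex or both from a shortest monochromatic path
  leaves shorter monochromatic paths. Nonadjacency forces at least one inner vertex, so the end
  edges differ.\<close>

lemma end_edges_exist:
  assumes mc: "MC_coloring V E c" and uv: "u \<in> V" "v \<in> V" "u \<noteq> v" "{u, v} \<notin> E"
  shows "\<exists>e f. end_edges V E c u v e f"
proof -
  obtain p where p: "mono_path V E c u v p" and len: "length p = mono_dist V E c u v"
    using mono_dist_attained[OF mc uv(1,2)] .
  have pb: "p \<noteq> []" "hd p = u" "last p = v" "distinct p" "path_edges p \<subseteq> E"
    using p by (auto simp: mono_path_def path_between_def)
  obtain b q where pq: "p = u # b # q"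
    using pb(1-3) uv(3) by (metis last.simps list.collapse list.exhaust)
  have "q \<noteq> []"
    using pb pq uv(4) by (auto simp: path_edges_Cons)
  moreover from this have "last q = v"
    using pb(3) pq by simp
  ultimately obtain r where q: "q = r @ [v]"
    by (metis append_butlast_last_id)
  \<comment> \<open>\<open>d\<close> is the predecessor of \<open>v\<close> on \<open>p\<close>,
    possibly \<open>b\<close> itself. Writing the reversed path as \<open>v # d # w\<close> lets
    \<open>mono_path_tl\<close> also cut off the last vertex.\<close>
  define d where "d = last (b # r)"
  define w where "w = rev (butlast (b # r)) @ [u]"
  have br: "b # r = butlast (b # r) @ [d]"
    unfolding d_def by (metis append_butlast_last_id list.distinct(1))
  have "rev (b # r) = d # rev (butlast (b # r))"
    by (subst br) simp
  then have dw: "d # w = rev (u # b # r)"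
    by (simp add: w_def)
  have rp: "rev p = v # d # w"
    unfolding dw by (simp add: pq q)
  have p1: "mono_path V E c b v (b # q)"
    using mono_path_tl p pq by metis
  have p2: "mono_path V E c d u (d # w)"
    using mono_path_tl mono_path_rev[OF p] rp by metis
  have p2': "mono_path V E c u d (u # b # r)"
    using mono_path_rev[OF p2] unfolding dw by simp
  have p3: "mono_path V E c b d (b # r)"
    using mono_path_tl p2' by metis
  have e: "{u, b} \<in> path_edges p"
    using pq by (simp add: path_edges_Cons)
  have f: "{d, v} \<in> path_edges p"
  proof -
    have "{v, d} \<in> path_edges (rev p)"
      unfolding rp by (simp add: path_edges_Cons)
    then show ?thesis by (simp add: path_edges_rev insert_commute)
  qed
  have "c {u, b} = c {d, v}"
    using p e f unfolding mono_path_def monochromatic_def by blast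
  moreover have "{u, b} \<noteq> {d, v}"
    using pb(4) pq q by (auto simp: doubleton_eq_iff)
  moreover have "mono_dist V E c b v < mono_dist V E c u v"
    using mono_dist_le[OF p1] len pq by simp
  moreover have "mono_dist V E c u d < mono_dist V E c u v"
    using mono_dist_le[OF p2'] len pq q by simp
  moreover have "mono_dist V E c b d < mono_dist V E c u v"
    using mono_dist_le[OF p3] len pq q by simp
  ultimately show ?thesis
    unfolding end_edges_def using e f pb(5) by blast
qed

text \<open>Any other choice of one endpoint in each of \<open>e\<close> and \<open>f\<close> would have to be both nearer and
  farther than \<open>u\<close> and \<open>v\<close>.\<close>

lemma end_edges_inj:
  assumes "end_edges V E c u v e f" "end_edges V E c u' v' e f"
  shows "u = u' \<and> v = v'"
proof -
  let ?D = "mono_dist V E c"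
  obtain b d where 1: "e = {u, b}" "f = {d, v}" "?D b v < ?D u v" "?D u d < ?D u v" "?D b d < ?D u v"
    using assms(1) unfolding end_edges_def by blast
  obtain b' d' where 2: "e = {u', b'}" "f = {d', v'}"
      "?D b' v' < ?D u' v'" "?D u' d' < ?D u' v'" "?D b' d' < ?D u' v'"
    using assms(2) unfolding end_edges_def by blast
  have "u = u' \<and> b = b' \<or> u = b' \<and> b = u'" "v = v' \<and> d = d' \<or> v = d' \<and> d = v'"
    using 1(1,2) 2(1,2) by (auto simp: doubleton_eq_iff)
  \<comment> \<open>Each case with a swap dies by one inequality: \<open>e\<close> alone by that for
    \<open>b\<close>, \<open>v\<close>; \<open>f\<close> alone by that for \<open>u\<close>,
    \<open>d\<close>; both by that for \<open>b\<close>, \<open>d\<close>.\<close>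
  then show ?thesis
    using 1(3-5) 2(3-5) by (elim disjE conjE) simp_all
qed

lemma card_nonadjacent_le:
  assumes mc: "MC_coloring V E c" and fin: "finite E"
  shows "card {{u, v} | u v. u \<in> V \<and> v \<in> V \<and> u \<noteq> v \<and> {u, v} \<notin> E}
    \<le> card {{e, f} | e f. e \<in> E \<and> f \<in> E \<and> e \<noteq> f \<and> c e = c f}" (is "card ?P \<le> card ?Q")
proof -
  define P where "P = ?P"
  define Q where "Q = ?Q"
  define R where "R A B \<longleftrightarrow> (\<exists>u v e f. A = {u, v} \<and> B = {e, f} \<and> end_edges V E c u v e f)" for A B
  have "\<exists>B. R A B \<and> B \<in> Q" if A: "A \<in> P" for A
  proof -
    obtain u v where uv: "A = {u, v}" "u \<in> V" "v \<in> V" "u \<noteq> v" "{u, v} \<notin> E"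
      using A unfolding P_def by blast
    obtain e f where ef: "end_edges V E c u v e f"
      using end_edges_exist[OF mc uv(2-5)] by blast
    then have "{e, f} \<in> Q" unfolding end_edges_def Q_def by blast
    moreover have "R A {e, f}" using uv(1) ef unfolding R_def by blast
    ultimately show ?thesis by blast
  qed
  then obtain h where h: "\<And>A. A \<in> P \<Longrightarrow> R A (h A)" "\<And>A. A \<in> P \<Longrightarrow> h A \<in> Q"
    by metis
  \<comment> \<open>\<open>R\<close> determines its first argument, so every choice function
    \<open>h\<close> for \<open>R\<close> is injective.\<close>
  have uniq: "A = A'" if AB: "R A B" and A'B: "R A' B" for A A' B
  proof -
    obtain u v e f where 1: "A = {u, v}" "B = {e, f}" "end_edges V E c u v e f"
      using AB unfolding R_def by blast
    obtain u' v' e' f' where 2: "A' = {u', v'}" "B = {e', f'}" "end_edges V E c u' v' e' f'"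
      using A'B unfolding R_def by blast
    consider "e' = e" "f' = f" | "e' = f" "f' = e"
      using 1(2) 2(2) by (auto simp: doubleton_eq_iff)
    then show ?thesis
    proof cases
      case 1
      with end_edges_inj \<open>end_edges V E c u v e f\<close> 2 \<open>A = {u, v}\<close> show ?thesis by metis
    next
      case swapped: 2
      with end_edges_inj end_edges_commute 1 2 show ?thesis by (metis insert_commute)
    qed
  qed
  have "inj_on h P"
    by (rule inj_onI) (metis uniq h(1))
  moreover have "h ` P \<subseteq> Q"
    using h(2) by blast
  moreover have "finite Q"
    unfolding Q_def by (rule finite_subset[of _ "Pow E"]) (use fin in auto)
  ultimately have "card P \<le> card Q"
    by (rule card_inj_on_le)
  then show ?thesis
    unfolding P_def Q_def .
qed

text \<open>Collapse one representative of every color to a single point: a pair of equally colored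
  elements is still determined by its image, because one of the two is not a representative.\<close>

lemma card_equal_color_pairs_le:
  fixes c :: "'b \<Rightarrow> 'c"
  assumes "finite E"
  shows "card {{e, f} | e f. e \<in> E \<and> f \<in> E \<and> e \<noteq> f \<and> c e = c f}
    \<le> Suc (card E - card (c ` E)) choose 2" (is "card ?Q \<le> _")
proof -
  define rep where "rep = inv_into E c"
  define S where "S = rep ` c ` E"
  \<comment> \<open>\<open>None\<close> is the collapsed point. The target then has one element more
    than there are non-representatives, that is, wasted colors.\<close>
  define h where "h e = (if e \<in> S then None else Some e)" for e
  have S_sub: "S \<subseteq> E"
    unfolding S_def rep_def by (auto intro: inv_into_into)
  have card_S: "card S = card (c ` E)"
    unfolding S_def rep_def by (rule card_image) (rule inj_on_inv_into, simp)
  have S_inj: "e = f" if "e \<in> S" "f \<in> S" "c e = c f" for e f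
    using that unfolding S_def rep_def by (auto simp: f_inv_into_f)
  have hE: "h ` E \<subseteq> insert None (Some ` (E - S))"
    by (auto simp: h_def)
  have fin: "finite (insert None (Some ` (E - S)))"
    using assms by simp
  have "card (insert None (Some ` (E - S))) = Suc (card E - card (c ` E))"
    using assms S_sub card_S by (simp add: card_image card_Diff_subset finite_subset image_iff)
  then have card2: "card {A. A \<subseteq> insert None (Some ` (E - S)) \<and> card A = 2}
      = Suc (card E - card (c ` E)) choose 2"
    using n_subsets[OF fin] by simp
  have h_inj: "e = f" if "h e = h f" "c e = c f" for e f
    using that S_inj by (auto simp: h_def split: if_splits)
  have "inj_on (\<lambda>A. h ` A) ?Q"
  proof (rule inj_onI)
    fix A B assume A: "A \<in> ?Q" and B: "B \<in> ?Q" and eq: "h ` A = h ` B"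
    obtain e f where ef: "A = {e, f}" "e \<noteq> f" "c e = c f" using A by blast
    obtain e' f' where ef': "B = {e', f'}" "e' \<noteq> f'" "c e' = c f'" using B by blast
    \<comment> \<open>A non-representative survives in the image unchanged, so it lies in both pairs
      and forces them to have the same color. On a single color \<open>h\<close> is
      injective.\<close>
    obtain d where d: "d \<in> A" "d \<notin> S"
      using ef S_inj by blast
    then have "Some d \<in> h ` A"
      unfolding h_def by force
    then have "d \<in> B"
      unfolding eq h_def by (auto split: if_splits)
    then have "c e = c e'"
      using d(1) ef ef' by auto
    then show "A = B"
      using eq ef ef' h_inj by (auto simp: doubleton_eq_iff)
  qed
  moreover have "(\<lambda>A. h ` A) ` ?Q \<subseteq> {A. A \<subseteq> insert None (Some ` (E - S)) \<and> card A = 2}"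
  proof
    fix X assume "X \<in> (\<lambda>A. h ` A) ` ?Q"
    then obtain e f where ef: "X = {h e, h f}" "e \<in> E" "f \<in> E" "e \<noteq> f" "c e = c f" by auto
    then have "h e \<noteq> h f" using h_inj by blast
    with ef hE show "X \<in> {A. A \<subseteq> insert None (Some ` (E - S)) \<and> card A = 2}" by auto
  qed
  moreover have "finite {A. A \<subseteq> insert None (Some ` (E - S)) \<and> card A = 2}"
    using fin by (simp add: finite_subset[of _ "Pow (insert None (Some ` (E - S)))"])
  ultimately have "card ?Q \<le> card {A. A \<subseteq> insert None (Some ` (E - S)) \<and> card A = 2}"
    by (rule card_inj_on_le)
  then show ?thesis using card2 by simp
qed

section \<open>Bounds on the monochromatic connection number\<close>

lemma simple_graph_finite_edges: "simple_graph V E \<Longrightarrow> finite E"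
  unfolding simple_graph_def by (meson Pow_iff finite_Pow_iff finite_subset subsetI)

text \<open>Every pair of vertices is an edge or nonadjacent; the nonadjacent ones are bounded
  through the equally colored pairs of edges.\<close>

lemma MC_coloring_missing_edges:
  assumes sg: "simple_graph V E" and mc: "MC_coloring V E c"
  shows "card V choose 2 \<le> card E + (Suc (card E - card (c ` E)) choose 2)"
proof -
  have finE: "finite E" using simple_graph_finite_edges[OF sg] .
  have finV: "finite V" using sg by (simp add: simple_graph_def)
  let ?P = "{{u, v} | u v. u \<in> V \<and> v \<in> V \<and> u \<noteq> v \<and> {u, v} \<notin> E}"
  have finP: "finite ?P"
    by (rule finite_subset[of _ "Pow V"]) (use finV in auto)
  have "card V choose 2 = card {A. A \<subseteq> V \<and> card A = 2}"
    using n_subsets[OF finV] by simp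
  also have "\<dots> \<le> card (E \<union> ?P)"
    by (rule card_mono) (use finE finP in \<open>auto simp: card_2_iff\<close>)
  also have "\<dots> \<le> card E + card ?P"
    by (rule card_Un_le)
  also have "card ?P \<le> Suc (card E - card (c ` E)) choose 2"
    using card_nonadjacent_le[OF mc finE] card_equal_color_pairs_le[OF finE, of c] by linarith
  finally show ?thesis by simp
qed

lemma finite_MC_color_counts:
  assumes "finite E" shows "finite {card (c ` E) | c. MC_coloring V E c}"
  by (rule finite_subset[of _ "{..card E}"]) (use assms card_image_le in auto)

lemma mc_ge:
  assumes "finite E" "MC_coloring V E c" shows "card (c ` E) \<le> mc V E"
  unfolding mc_def by (rule Max_ge) (use assms finite_MC_color_counts in auto)

lemma mc_attained:
  assumes "connected_graph V E"
  obtains c where "MC_coloring V E c" "mc V E = card (c ` E)"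
proof -
  have "finite E"
    using assms simple_graph_finite_edges by (auto simp: connected_graph_def)
  moreover have "MC_coloring V E (\<lambda>_. 0)"
    using assms by (auto simp: connected_graph_def MC_coloring_def monochromatic_def)
  ultimately have "Max {card (c ` E) | c. MC_coloring V E c} \<in> {card (c ` E) | c. MC_coloring V E c}"
    by (intro Max_in finite_MC_color_counts) auto
  with that show thesis by (auto simp: mc_def)
qed

lemma mc_le_card_edges:
  assumes "connected_graph V E" shows "mc V E \<le> card E"
proof -
  have "finite E"
    using assms simple_graph_finite_edges by (auto simp: connected_graph_def)
  with mc_attained[OF assms] show ?thesis by (metis card_image_le)
qed

lemma connected_graph_if_MC_coloring:
  "simple_graph V E \<Longrightarrow> V \<noteq> {} \<Longrightarrow> MC_coloring V E c \<Longrightarrow> connected_graph V E"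
  unfolding connected_graph_def MC_coloring_def by blast

section \<open>Graphs whose missing edges lie among the leaves of a star\<close>

text \<open>Delete \<open>x\<close> pairs of leaves \<open>1..s\<close> from the complete graph on
  \<open>{..<n}\<close>. The star with center \<open>0\<close> stays intact and joins every deleted
  pair by a path of length two.\<close>

lemma star_graph_mc:
  assumes s: "1 \<le> s" "s < n" and x: "x \<le> s choose 2"
  obtains V :: "nat set" and E where "connected_graph V E" "card V = n"
    "card E = (n choose 2) - x" "(n choose 2) - x \<le> mc V E + (s - 1)"
proof -
  define V where "V = {..<n}"
  have "card {A. A \<subseteq> {1..s} \<and> card A = 2} = s choose 2"
    using n_subsets[of "{1..s}" 2] by simp
  with x obtain X where X: "X \<subseteq> {A. A \<subseteq> {1..s} \<and> card A = 2}" "card X = x" "finite X"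
    using obtain_subset_with_card_n[of x "{A. A \<subseteq> {1..s} \<and> card A = 2}"] by auto
  define E where "E = {A. A \<subseteq> V \<and> card A = 2} - X"
  have fin2: "finite {A. A \<subseteq> V \<and> card A = 2}"
    by (rule finite_subset[of _ "Pow V"]) (auto simp: V_def)
  have finE: "finite E" using fin2 by (simp add: E_def)
  have XV: "X \<subseteq> {A. A \<subseteq> V \<and> card A = 2}"
  proof -
    have "{1..s} \<subseteq> V"
      using s(2) by (auto simp: V_def)
    with X(1) show ?thesis by blast
  qed
  have cardE: "card E = (n choose 2) - x"
    using n_subsets[of V 2] X(2,3) XV by (simp add: E_def card_Diff_subset V_def)
  have sg: "simple_graph V E"
    by (auto simp: simple_graph_def V_def E_def)
  define S where "S = (\<lambda>i. {0, i}) ` {1..s}"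
  have edge: "{u, v} \<in> E" if "u \<in> V" "v \<in> V" "u \<noteq> v" "{u, v} \<notin> X" for u v
    using that by (auto simp: E_def)
  have S_sub: "S \<subseteq> E"
    using X(1) s(2) by (auto simp: S_def E_def V_def)
  have "inj_on (\<lambda>i. {0, i}) {1..s}"
    by (rule inj_onI) (auto simp: doubleton_eq_iff)
  then have card_S: "card S = s" by (simp add: S_def card_image)
  obtain g :: "nat set \<Rightarrow> nat" where g: "inj_on g E"
    using finE finite_imp_inj_to_nat_seg by blast
  \<comment> \<open>Color \<open>0\<close> is reserved for the star; \<open>Suc (g e)\<close> gives
    each remaining edge a private color.\<close>
  define c where "c e = (if e \<in> S then 0 else Suc (g e))" for e
  have img: "c ` E = insert 0 ((\<lambda>e. Suc (g e)) ` (E - S))"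
  proof -
    have "S \<noteq> {}" using s(1) by (auto simp: S_def)
    then show ?thesis using S_sub by (auto simp: c_def)
  qed
  have "inj_on (\<lambda>e. Suc (g e)) (E - S)"
    using g by (auto simp: inj_on_def)
  then have "card ((\<lambda>e. Suc (g e)) ` (E - S)) = card E - s"
    using S_sub finE card_S by (simp add: card_image card_Diff_subset finite_subset)
  then have card_img: "card (c ` E) = Suc (card E - s)"
    using finE by (simp add: img image_iff)
  have mc: "MC_coloring V E c"
    unfolding MC_coloring_def
  proof (intro ballI)
    fix u v assume uv: "u \<in> V" "v \<in> V"
    consider "u = v" | "u \<noteq> v" "{u, v} \<in> E" | "u \<noteq> v" "{u, v} \<in> X"
      using edge uv by blast
    then show "\<exists>p. path_between V E u v p \<and> monochromatic c (path_edges p)"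
    proof cases
      case 1
      then show ?thesis using uv
        by (intro exI[of _ "[u]"]) (auto simp: path_between_def path_edges_singleton monochromatic_def)
    next
      case 2
      then show ?thesis using uv
        by (intro exI[of _ "[u, v]"])
          (auto simp: path_between_def path_edges_Cons path_edges_singleton monochromatic_def)
    next
      case 3
      then have "u \<in> {1..s}" "v \<in> {1..s}" using X(1) by auto
      then have S: "{u, 0} \<in> S" "{0, v} \<in> S" and "u \<noteq> 0" "v \<noteq> 0"
        by (auto simp: S_def insert_commute)
      moreover have "0 \<in> V" using s by (simp add: V_def)
      ultimately show ?thesis using uv S_sub 3(1)
        by (intro exI[of _ "[u, 0, v]"])
          (auto simp: path_between_def path_edges_Cons path_edges_singleton monochromatic_def c_def)
    qed
  qed
  have "V \<noteq> {}" using s by (auto simp: V_def)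
  then have "connected_graph V E"
    using connected_graph_if_MC_coloring sg mc by blast
  moreover have "card E \<le> mc V E + (s - 1)"
    using mc_ge[OF finE mc] card_img by linarith
  ultimately show thesis
    using that[of V E] cardE by (simp add: V_def)
qed

section \<open>The Erdos-Gallai-type function\<close>

text \<open>With \<open>k + i\<close> edges and more than \<open>k\<close> colors, at most
  \<open>i - 1\<close> colors are wasted. The missing pairs then number at most
  \<open>i choose 2\<close>, which is too few since \<open>i\<close> is at most
  \<open>j\<close>.\<close>

lemma mc_le_if_few_edges:
  assumes conn: "connected_graph V E" and "card V = n" "card E \<le> k + j"
    and "k + (Suc j choose 2) < n choose 2"
  shows "mc V E \<le> k"
proof (rule ccontr)
  assume *: "\<not> mc V E \<le> k"
  obtain c where c: "MC_coloring V E c" "mc V E = card (c ` E)"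
    using mc_attained[OF conn] .
  have sg: "simple_graph V E" using conn by (simp add: connected_graph_def)
  obtain i where i: "card E = k + i" "0 < i" "i \<le> j"
    using * mc_le_card_edges[OF conn] assms(3)
    by (metis add_le_cancel_left le_add_diff_inverse less_le_trans linorder_not_le nless_le
        less_imp_le zero_less_diff)
  have "Suc (card E - card (c ` E)) \<le> i"
    using * c(2) i by linarith
  then have "Suc (card E - card (c ` E)) choose 2 \<le> i choose 2"
    by (rule binomial_right_mono)
  then have "n choose 2 \<le> k + i + (i choose 2)"
    using MC_coloring_missing_edges[OF sg c(1)] unfolding i(1) assms(2) by linarith
  also have "\<dots> = k + (Suc i choose 2)"
    by (simp add: numeral_2_eq_2)
  also have "\<dots> \<le> k + (Suc j choose 2)"
    using i(3) binomial_right_mono[of "Suc i" "Suc j" 2] by simp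
  finally show False using assms(4) by simp
qed

text \<open>One bad graph with \<open>Suc m\<close> edges excludes every larger candidate. At
  \<open>m = n choose 2\<close> none is required, because the cap in \<open>g_mc\<close> already
  stops there.\<close>

lemma g_mc_eqI:
  assumes "m \<le> n choose 2"
    and "\<And>(V :: nat set) E. connected_graph V E \<Longrightarrow> card V = n \<Longrightarrow> card E \<le> m \<Longrightarrow> mc V E \<le> k"
    and "m < n choose 2 \<Longrightarrow>
      \<exists>(V :: nat set) E. connected_graph V E \<and> card V = n \<and> card E = Suc m \<and> k < mc V E"
  shows "g_mc n k = m"
  unfolding g_mc_def
proof (rule Max_eqI)
  show "finite {m. m \<le> n choose 2 \<and>
     (\<forall>(V :: nat set) E. connected_graph V E \<and> card V = n \<and> card E \<le> m \<longrightarrow> mc V E \<le> k)}"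
    by (rule finite_subset[of _ "{..n choose 2}"]) auto
next
  fix y assume y: "y \<in> {m. m \<le> n choose 2 \<and>
     (\<forall>(V :: nat set) E. connected_graph V E \<and> card V = n \<and> card E \<le> m \<longrightarrow> mc V E \<le> k)}"
  show "y \<le> m"
  proof (rule ccontr)
    assume "\<not> y \<le> m"
    with y assms(3) obtain V :: "nat set" and E where
      "connected_graph V E" "card V = n" "card E = Suc m" "k < mc V E" by auto
    moreover have "Suc m \<le> y"
      using \<open>\<not> y \<le> m\<close> by simp
    ultimately have "mc V E \<le> k"
      using y by simp
    then show False
      using \<open>k < mc V E\<close> by simp
  qed
qed (use assms(1,2) in auto)

text \<open>\<open>lower\<close> bounds \<open>mc\<close> for up to \<open>k + j\<close> edges. By
  \<open>upper\<close>, the pairs missing from a graph with \<open>k + j + 1\<close> edges fit among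
  the leaves of a star with \<open>Suc j\<close> edges; it wastes only \<open>j\<close> colors,
  leaving \<open>k + 1\<close>.\<close>

lemma g_mc_eq_add:
  assumes s: "j < n - 1" and lower: "k + (Suc j choose 2) < n choose 2"
    and upper: "n choose 2 \<le> k + Suc j + (Suc j choose 2)"
    and small: "k + j < n choose 2"
  shows "g_mc n k = k + j"
proof (rule g_mc_eqI)
  show "k + j \<le> n choose 2" using small by simp
  show "mc V E \<le> k" if "connected_graph V E" "card V = n" "card E \<le> k + j" for V :: "nat set" and E
    using mc_le_if_few_edges that lower by blast
  have "1 \<le> Suc j" "Suc j < n" "(n choose 2) - (k + Suc j) \<le> Suc j choose 2"
    using s upper by auto
  from star_graph_mc[OF this] obtain V :: "nat set" and E where VE:
    "connected_graph V E" "card V = n" "card E = (n choose 2) - ((n choose 2) - (k + Suc j))"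
    "(n choose 2) - ((n choose 2) - (k + Suc j)) \<le> mc V E + (Suc j - 1)" .
  \<comment> \<open>\<open>small\<close> rules out truncation in the inner subtraction.\<close>
  have "(n choose 2) - ((n choose 2) - (k + Suc j)) = Suc (k + j)"
    using small by simp
  with VE have "card E = Suc (k + j)" "k < mc V E" by auto
  with VE show "\<exists>(V :: nat set) E. connected_graph V E \<and> card V = n \<and> card E = Suc (k + j) \<and> k < mc V E"
    by blast
qed

text \<open>Pairs in a disjoint union lie inside one part or run across. It is applied with parts of
  sizes \<open>n - t\<close> and \<open>t\<close>.\<close>

lemma choose_two_add: "(a + b) choose 2 = (a choose 2) + a * b + (b choose 2)"
  by (induction b) (auto simp: numeral_2_eq_2)

theorem theorem4:
  fixes n k :: nat
  assumes "1 \<le> n" and "1 \<le> k" and "k \<le> n choose 2"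
  shows "(k = n choose 2 \<longrightarrow> g_mc n k = n choose 2) \<and>
    (\<forall>t::nat. 2 \<le> t \<and> t \<le> n - 1 \<longrightarrow>
      (((n - t) choose 2) + t * (n - t - 1) + 1 \<le> k \<and>
         k \<le> ((n - t) choose 2) + t * (n - t) - 1 \<longrightarrow> g_mc n k = k + t - 1) \<and>
      (k = ((n - t) choose 2) + t * (n - t) \<longrightarrow> g_mc n k = k + t - 2))"
proof (intro conjI impI allI)
  assume k: "k = n choose 2"
  show "g_mc n k = n choose 2"
    by (rule g_mc_eqI) (use k mc_le_card_edges in \<open>auto intro: order_trans\<close>)
next
  fix t assume t: "2 \<le> t \<and> t \<le> n - 1"
    and k: "((n - t) choose 2) + t * (n - t - 1) + 1 \<le> k \<and> k \<le> ((n - t) choose 2) + t * (n - t) - 1"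
  \<comment> \<open>The names hide the nonlinear products from \<open>linarith\<close>; the excess
    over \<open>k\<close> is \<open>t - 1\<close>, so the star has \<open>t\<close> edges.\<close>
  define j A B D where "j = t - 1" and "A = t * (n - t)" and "B = t * (n - t - 1)"
    and "D = (n - t) choose 2"
  note defs = this
  have j: "t = Suc j" "j < n - 1" using t unfolding defs by linarith+
  have "n - t + t = n" using t by linarith
  then have N: "n choose 2 = D + A + (t choose 2)"
    using choose_two_add[of "n - t" t] by (simp add: mult.commute defs)
  have "B + t = A" "0 < A"
    unfolding defs using t by (cases "n - t"; auto)+
  moreover have "D + B + 1 \<le> k" "k \<le> D + A - 1"
    using k unfolding defs by auto
  moreover have "t choose 2 = j + (j choose 2)"
    unfolding j(1) by (simp add: numeral_2_eq_2)
  ultimately have "k + (t choose 2) < n choose 2" "n choose 2 \<le> k + t + (t choose 2)"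
      "k + j < n choose 2"
    using N by linarith+
  with j have "g_mc n k = k + j"
    by (intro g_mc_eq_add) simp_all
  then show "g_mc n k = k + t - 1" using j by simp
next
  fix t assume t: "2 \<le> t \<and> t \<le> n - 1" and k: "k = ((n - t) choose 2) + t * (n - t)"
  \<comment> \<open>Here \<open>k + (t choose 2)\<close> equals \<open>n choose 2\<close>, so the
    strict bound fails for excess \<open>t - 1\<close>. With \<open>t - 2\<close> it holds, and the
    upper condition becomes an equality.\<close>
  define j where "j = t - 2"
  have j: "t = Suc (Suc j)" using t by (auto simp: j_def)
  have "n - t + t = n" using t by linarith
  then have N: "n choose 2 = k + (t choose 2)"
    using choose_two_add[of "n - t" t] k by (simp add: mult.commute)
  have "t choose 2 = Suc j + (Suc j choose 2)" "Suc j choose 2 = j + (j choose 2)"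
    unfolding j by (simp_all add: numeral_2_eq_2)
  moreover have "j < n - 1"
    using t j by linarith
  ultimately have "g_mc n k = k + j"
    using N by (intro g_mc_eq_add) linarith+
  then show "g_mc n k = k + t - 2" using j by simp
qed

end
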